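(* Let $X$ be a countably based topological space. Then $\mathbf{K}(\mathbf{A}(X))$ with the upper Vietoris topology is homeomorphic to $\mathbf{O}(\mathbf{O}(X))$ with the Scott topology, via the map $\phi\colon\mathbf{K}(\mathbf{A}(X))\to\mathbf{O}(\mathbf{O}(X))$ and its inverse $\psi\colon\mathbf{O}(\mathbf{O}(X))\to\mathbf{K}(\mathbf{A}(X))$. Moreover, the Scott topology on $\mathbf{O}(\mathbf{O}(X))$ has a subbasis given by the sets $$\boxtimes U=\{\mathcal{H}\in\mathbf{O}(\mathbf{O}(X))\mid U\in\mathcal{H}\}$$ for open $U\subseteq X$.
   Context: For a topological space $Y$: $\mathbf{A}(Y)$ is the set of all closed subsets of $Y$ with the lower Vietoris topology, generated by the sets $\Diamond U=\{A\in\mathbf{A}(Y)\mid A\cap U\neq\emptyset\}$ for $U\subseteq Y$ open. $\mathbf{K}(Y)$ is the set of all compact saturated subsets of $Y$ with the upper Vietoris topology, generated by the sets $\Box U=\{K\in\mathbf{K}(Y)\mid K\subseteq U\}$ for $U\subseteq Y$ open. (Compact: every open cover has a finite subcover. Saturated: equal to the intersection of all its open neighborhoods.) $\mathbf{O}(Y)$ is the lattice of open subsets of $Y$ ordered by inclusion and equipped with the Scott topology; so $\mathbf{O}(\mathbf{O}(X))$ is the lattice of Scott-open subsets of $\mathbf{O}(X)$, again with its Scott topology. The maps (which are well-defined for every topological space $X$) are $$\phi(\mathcal{K})=\{U\in\mathbf{O}(X)\mid\mathcal{K}\in\Box\Diamond U\},\qquad\psi(\mathcal{H})=\bigcap_{U\in\mathcal{H}}\Diamond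 U,$$ where $\Box\Diamond U=\{\mathcal{K}\in\mathbf{K}(\mathbf{A}(X))\mid(\forall A\in\mathcal{K})\,A\cap U\neq\emptyset\}$ and the empty intersection is $\mathbf{A}(X)$. *)

theory Defs
  imports "HOL-Analysis.Analysis" "HOL-Library.Lub_Glb"
begin

text \<open>The topology on \<open>S\<close> with subbasis \<open>\<B>\<close>. The whole space \<open>S\<close> counts as the empty
  intersection, so \<open>\<B>\<close> need not cover \<open>S\<close> (unlike for \<^const>\<open>topology_generated_by\<close>); this
  matters below, since the empty closed set meets no open set.\<close>

definition topology_from_subbasis :: "'a set \<Rightarrow> 'a set set \<Rightarrow> 'a topology" where
  "topology_from_subbasis S \<B> =
     topology (arbitrary union_of (finite intersection_of (\<lambda>B. B \<in> \<B>) relative_to S))"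

lemma openin_topology_from_subbasis:
  "openin (topology_from_subbasis S \<B>) =
     arbitrary union_of (finite intersection_of (\<lambda>B. B \<in> \<B>) relative_to S)"
  unfolding topology_from_subbasis_def by (simp add: istopology_subbase)

lemma topspace_topology_from_subbasis [simp]: "topspace (topology_from_subbasis S \<B>) = S"
  unfolding topology_from_subbasis_def by (simp add: topspace_subbase)


definition directed_subset :: "'a::order set \<Rightarrow> bool" where
  "directed_subset D \<longleftrightarrow> D \<noteq> {} \<and> (\<forall>x\<in>D. \<forall>y\<in>D. \<exists>z\<in>D. x \<le> z \<and> y \<le> z)"

definition scott_open :: "'a::order set \<Rightarrow> 'a set \<Rightarrow> bool" where
  "scott_open P W \<longleftrightarrow>
     W \<subseteq> P \<and>
     (\<forall>x\<in>W. \<forall>y\<in>P. x \<le> y \<longrightarrow> y \<in> W) \<and>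
     (\<forall>D s. D \<subseteq> P \<longrightarrow> directed_subset D \<longrightarrow> isLub P D s \<longrightarrow> s \<in> W \<longrightarrow> D \<inter> W \<noteq> {})"

definition scott_topology :: "'a::order set \<Rightarrow> 'a topology" where
  "scott_topology P = topology (scott_open P)"

lemma scott_openI:
  assumes "W \<subseteq> P"
    and "\<And>x y. x \<in> W \<Longrightarrow> y \<in> P \<Longrightarrow> x \<le> y \<Longrightarrow> y \<in> W"
    and "\<And>D s. D \<subseteq> P \<Longrightarrow> directed_subset D \<Longrightarrow> isLub P D s \<Longrightarrow> s \<in> W \<Longrightarrow> \<exists>d\<in>D. d \<in> W"
  shows "scott_open P W"
  unfolding scott_open_def
proof (intro conjI allI impI ballI)
  show "W \<subseteq> P" by (fact assms(1))
  show "y \<in> W" if "x \<in> W" "y \<in> P" "x \<le> y" for x y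
    using that by (rule assms(2))
  show "D \<inter> W \<noteq> {}" if "D \<subseteq> P" "directed_subset D" "isLub P D s" "s \<in> W" for D s
    using assms(3)[OF that] by auto
qed

lemma scott_open_subset: "scott_open P W \<Longrightarrow> W \<subseteq> P"
  unfolding scott_open_def by (elim conjE)

lemma scott_open_up: "scott_open P W \<Longrightarrow> x \<in> W \<Longrightarrow> x \<le> y \<Longrightarrow> y \<in> P \<Longrightarrow> y \<in> W"
  unfolding scott_open_def by (elim conjE) simp

lemma scott_open_directed:
  assumes "scott_open P W" "D \<subseteq> P" "directed_subset D" "isLub P D s" "s \<in> W"
  shows "\<exists>d\<in>D. d \<in> W"
proof -
  have "D \<inter> W \<noteq> {}"
    using assms(1) unfolding scott_open_def
    by (elim conjE allE[of _ D] allE[of _ s]) (simp add: assms)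
  then show ?thesis by auto
qed

lemma istopology_scott_open: "istopology (scott_open P)"
  unfolding istopology_def
proof (intro conjI allI impI)
  fix V W assume V: "scott_open P V" and W: "scott_open P W"
  show "scott_open P (V \<inter> W)"
  proof (rule scott_openI)
    show "V \<inter> W \<subseteq> P"
      using scott_open_subset[OF V] by blast
    show "y \<in> V \<inter> W" if "x \<in> V \<inter> W" "y \<in> P" "x \<le> y" for x y
      using that scott_open_up[OF V] scott_open_up[OF W] by auto
    show "\<exists>d\<in>D. d \<in> V \<inter> W"
      if D: "D \<subseteq> P" "directed_subset D" "isLub P D s" "s \<in> V \<inter> W" for D s
    proof -
      obtain x where x: "x \<in> D" "x \<in> V"
        using scott_open_directed[OF V D(1-3)] D(4) by auto
      obtain y where y: "y \<in> D" "y \<in> W"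
        using scott_open_directed[OF W D(1-3)] D(4) by auto
      obtain z where z: "z \<in> D" "x \<le> z" "y \<le> z"
        using D(2) x(1) y(1) unfolding directed_subset_def by metis
      have "z \<in> P" using z(1) D(1) by auto
      then have "z \<in> V" "z \<in> W"
        using scott_open_up[OF V x(2)] scott_open_up[OF W y(2)] z by auto
      then show ?thesis using z(1) by auto
    qed
  qed
next
  fix \<W> assume \<W>: "\<forall>W\<in>\<W>. scott_open P W"
  show "scott_open P (\<Union>\<W>)"
  proof (rule scott_openI)
    show "\<Union>\<W> \<subseteq> P"
      using \<W> scott_open_subset by (metis Sup_least)
    show "y \<in> \<Union>\<W>" if "x \<in> \<Union>\<W>" "y \<in> P" "x \<le> y" for x y
      using that \<W> scott_open_up by (metis UnionE UnionI)
    show "\<exists>d\<in>D. d \<in> \<Union>\<W>"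
      if D: "D \<subseteq> P" "directed_subset D" "isLub P D s" "s \<in> \<Union>\<W>" for D s
    proof -
      obtain W where W: "W \<in> \<W>" "s \<in> W" using D(4) by auto
      then have "scott_open P W" using \<W> by auto
      from scott_open_directed[OF this D(1-3) W(2)] W(1) show ?thesis by auto
    qed
  qed
qed

lemma openin_scott_topology [simp]: "openin (scott_topology P) = scott_open P"
  unfolding scott_topology_def by (simp add: istopology_scott_open)

lemma topspace_scott_topology [simp]: "topspace (scott_topology P) = P"
proof -
  have "scott_open P P"
    by (rule scott_openI) (auto simp: directed_subset_def)
  then show ?thesis
    unfolding topspace_def by (auto dest: scott_open_subset)
qed

definition opens_space :: "'a topology \<Rightarrow> 'a set topology"  (\<open>\<^bold>O\<close>) where
  "\<^bold>O Y = scott_topology {U. openin Y U}"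

lemma topspace_opens_space [simp]: "topspace (\<^bold>O Y) = {U. openin Y U}"
  unfolding opens_space_def by simp

lemma isLub_open_sets:
  assumes "D \<subseteq> {U. openin Y U}"
  shows "isLub {U. openin Y U} D s \<longleftrightarrow> s = \<Union>D"
proof -
  have "openin Y (\<Union>D)"
    using assms by (auto intro: openin_Union)
  then have lub: "isLub {U. openin Y U} D (\<Union>D)"
    by (auto simp: isLub_def leastP_def isUb_def setle_def setge_def)
  show ?thesis
  proof
    assume s: "isLub {U. openin Y U} D s"
    show "s = \<Union>D"
    proof (rule order_antisym)
      show "s \<subseteq> \<Union>D"
        using s lub by (simp add: isLub_def leastP_def setge_def)
      show "\<Union>D \<subseteq> s"
        using s lub by (simp add: isLub_def leastP_def setge_def)
    qed
  qed (simp add: lub)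
qed


definition closed_sets :: "'a topology \<Rightarrow> 'a set set" where
  "closed_sets Y = {A. closedin Y A}"

definition vietoris_diamond :: "'a topology \<Rightarrow> 'a set \<Rightarrow> 'a set set" where
  "vietoris_diamond Y U = {A \<in> closed_sets Y. A \<inter> U \<noteq> {}}"

definition lower_space :: "'a topology \<Rightarrow> 'a set topology"  (\<open>\<^bold>A\<close>) where
  "\<^bold>A Y = topology_from_subbasis (closed_sets Y) {vietoris_diamond Y U |U. openin Y U}"

lemma topspace_lower_space [simp]: "topspace (\<^bold>A Y) = closed_sets Y"
  unfolding lower_space_def by simp


definition saturatedin :: "'a topology \<Rightarrow> 'a set \<Rightarrow> bool" where
  "saturatedin Y K \<longleftrightarrow> K = \<Inter>{U. openin Y U \<and> K \<subseteq> U}"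

definition compact_saturated_sets :: "'a topology \<Rightarrow> 'a set set" where
  "compact_saturated_sets Y = {K. compactin Y K \<and> saturatedin Y K}"

definition vietoris_box :: "'a topology \<Rightarrow> 'a set \<Rightarrow> 'a set set" where
  "vietoris_box Y U = {K \<in> compact_saturated_sets Y. K \<subseteq> U}"

definition upper_space :: "'a topology \<Rightarrow> 'a set topology"  (\<open>\<^bold>K\<close>) where
  "\<^bold>K Y = topology_from_subbasis (compact_saturated_sets Y) {vietoris_box Y U |U. openin Y U}"

lemma topspace_upper_space [simp]: "topspace (\<^bold>K Y) = compact_saturated_sets Y"
  unfolding upper_space_def by simp


definition phi :: "'a topology \<Rightarrow> 'a set set \<Rightarrow> 'a set set"  (\<open>\<phi>\<close>) where
  "\<phi> X \<K> = {U. openin X U \<and> \<K> \<in> vietoris_box (\<^bold>A X) (vietoris_diamond X U)}"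

definition psi :: "'a topology \<Rightarrow> 'a set set \<Rightarrow> 'a set set"  (\<open>\<psi>\<close>) where
  "\<psi> X \<H> = closed_sets X \<inter> (\<Inter>U\<in>\<H>. vietoris_diamond X U)"

definition boxtimes :: "'a topology \<Rightarrow> 'a set \<Rightarrow> 'a set set set"  (\<open>\<boxtimes>\<close>) where
  "\<boxtimes> X U = {\<H>. openin (\<^bold>O X) \<H> \<and> U \<in> \<H>}"

end

theory Submission
  imports Defs
begin

text \<open>A set \<open>\<K>\<close> of closed sets is compact iff the open sets \<open>U\<close> with \<open>\<K> \<subseteq> \<diamond>U\<close> form a Scott open
  family: one direction is the definition of compactness, the other is Alexander's subbase lemma.
  A saturated \<open>\<K>\<close> is closed under enlarging its members, hence is determined by this family: a
  closed \<open>A\<close> lies outside \<open>\<K>\<close> iff its complement belongs to the family. So \<open>\<phi>\<close> and \<open>\<psi>\<close> are mutually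
  inverse for every \<open>X\<close>. Since a finite union of diamonds is a diamond, the sets \<open>\<box>\<diamond>U\<close> form a
  subbasis of the upper Vietoris topology, and they correspond to the sets \<open>\<boxtimes> X U\<close>.

  Countability enters only to show that the sets \<open>\<boxtimes> X U\<close> generate the Scott topology. They
  generate a topology with countable neighbourhood bases, so it suffices to see that its convergent
  sequences \<open>\<N> n\<close> converge in the Scott topology as well; for a limit \<open>\<H>\<close>, this holds because the
  sets \<open>\<H> \<inter> (\<Inter>m\<ge>n. \<N> m)\<close> are Scott open and increase to \<open>\<H>\<close>.\<close>

section \<open>Topologies given by a subbasis\<close>

lemma openin_topology_from_subbasis_iff:
  "openin (topology_from_subbasis S \<B>) W \<longleftrightarrow>
     W \<subseteq> S \<and> (\<forall>x\<in>W. \<exists>\<F>. finite \<F> \<and> \<F> \<subseteq> \<B> \<and> x \<in> \<Inter>\<F> \<and> S \<inter> \<Inter>\<F> \<subseteq> W)"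
proof -
  have basic: "(finite intersection_of (\<lambda>B. B \<in> \<B>) relative_to S) V \<longleftrightarrow>
      (\<exists>\<F>. finite \<F> \<and> \<F> \<subseteq> \<B> \<and> V = S \<inter> \<Inter>\<F>)" for V
    unfolding relative_to_def intersection_of_def by auto
  have "(\<exists>V. (\<exists>\<F>. finite \<F> \<and> \<F> \<subseteq> \<B> \<and> V = S \<inter> \<Inter>\<F>) \<and> x \<in> V \<and> V \<subseteq> W) \<longleftrightarrow>
      x \<in> S \<and> (\<exists>\<F>. finite \<F> \<and> \<F> \<subseteq> \<B> \<and> x \<in> \<Inter>\<F> \<and> S \<inter> \<Inter>\<F> \<subseteq> W)" for x
    by auto
  then show ?thesis
    unfolding openin_topology_from_subbasis arbitrary_union_of_alt basic
    by (simp add: subset_iff) blast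
qed

lemma openin_subbasis_member:
  assumes "B \<in> \<B>" "B \<subseteq> S"
  shows "openin (topology_from_subbasis S \<B>) B"
  unfolding openin_topology_from_subbasis_iff
  using assms by (intro conjI ballI exI[of _ "{B}"]) auto

lemma openin_topology_from_subbasis_minimal:
  assumes "openin (topology_from_subbasis S \<B>) W" "openin T S" "\<And>B. B \<in> \<B> \<Longrightarrow> openin T B"
  shows "openin T W"
  using assms(3,2,1) unfolding topology_from_subbasis_def by (rule minimal_topology_subbase)

lemma continuous_map_into_topology_from_subbasis:
  assumes "\<And>x. x \<in> topspace T \<Longrightarrow> f x \<in> S"
    and "\<And>B. B \<in> \<B> \<Longrightarrow> openin T {x \<in> topspace T. f x \<in> B}"
  shows "continuous_map T (topology_from_subbasis S \<B>) f"
  using assms unfolding topology_from_subbasis_def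
  by (intro continuous_map_into_topology_subbase) auto

lemma homeomorphic_maps_topology_from_subbasis:
  assumes f: "\<And>x. x \<in> S \<Longrightarrow> f x \<in> T" and g: "\<And>y. y \<in> T \<Longrightarrow> g y \<in> S"
    and gf: "\<And>x. x \<in> S \<Longrightarrow> g (f x) = x" and fg: "\<And>y. y \<in> T \<Longrightarrow> f (g y) = y"
    and B: "\<And>i. i \<in> I \<Longrightarrow> B i \<subseteq> S" and C: "\<And>i. i \<in> I \<Longrightarrow> C i \<subseteq> T"
    and f_in_C_iff: "\<And>i x. i \<in> I \<Longrightarrow> x \<in> S \<Longrightarrow> f x \<in> C i \<longleftrightarrow> x \<in> B i"
  shows "homeomorphic_maps
    (topology_from_subbasis S (B ` I)) (topology_from_subbasis T (C ` I)) f g"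
  unfolding homeomorphic_maps_def
proof (intro conjI ballI)
  show "continuous_map (topology_from_subbasis S (B ` I)) (topology_from_subbasis T (C ` I)) f"
  proof (rule continuous_map_into_topology_from_subbasis)
    fix V assume "V \<in> C ` I"
    then obtain i where i: "i \<in> I" "V = C i" by blast
    have "{x \<in> S. f x \<in> V} = B i"
      using f_in_C_iff[OF i(1)] B[OF i(1)] by (auto simp: i(2))
    with i(1) show "openin (topology_from_subbasis S (B ` I))
        {x \<in> topspace (topology_from_subbasis S (B ` I)). f x \<in> V}"
      by (simp add: openin_subbasis_member B)
  qed (simp add: f)
  show "continuous_map (topology_from_subbasis T (C ` I)) (topology_from_subbasis S (B ` I)) g"
  proof (rule continuous_map_into_topology_from_subbasis)
    fix V assume "V \<in> B ` I"
    then obtain i where i: "i \<in> I" "V = B i" by blast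
    have "g y \<in> B i \<longleftrightarrow> y \<in> C i" if "y \<in> T" for y
      using f_in_C_iff[OF i(1) g[OF that]] by (simp add: fg that)
    then have "{y \<in> T. g y \<in> V} = C i"
      using C[OF i(1)] by (auto simp: i(2))
    with i(1) show "openin (topology_from_subbasis T (C ` I))
        {y \<in> topspace (topology_from_subbasis T (C ` I)). g y \<in> V}"
      by (simp add: openin_subbasis_member C)
  qed (simp add: g)
qed (simp_all add: gf fg)

lemma subtopology_topology_from_subbasis:
  "subtopology (topology_from_subbasis S \<B>) K = topology_from_subbasis (S \<inter> K) \<B>"
  unfolding topology_eq openin_topology_from_subbasis
  by (simp add: arbitrary_union_of_relative_to openin_topology_from_subbasis
      flip: openin_relative_to)

lemma topology_from_subbasis_insert_carrier:
  "topology_from_subbasis S (insert S \<B>) = topology_from_subbasis S \<B>"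
proof -
  have "(\<exists>\<F>. finite \<F> \<and> \<F> \<subseteq> insert S \<B> \<and> x \<in> \<Inter>\<F> \<and> S \<inter> \<Inter>\<F> \<subseteq> W) \<longleftrightarrow>
      (\<exists>\<F>. finite \<F> \<and> \<F> \<subseteq> \<B> \<and> x \<in> \<Inter>\<F> \<and> S \<inter> \<Inter>\<F> \<subseteq> W)" (is "?L \<longleftrightarrow> ?R") for x W
  proof
    assume ?L
    then obtain \<F> where "finite \<F>" "\<F> \<subseteq> insert S \<B>" "x \<in> \<Inter>\<F>" "S \<inter> \<Inter>\<F> \<subseteq> W" by blast
    then show ?R by (intro exI[of _ "\<F> - {S}"]) auto
  qed blast
  then show ?thesis
    unfolding topology_eq openin_topology_from_subbasis_iff by simp
qed

lemma compactin_topology_from_subbasis: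
  assumes "K \<subseteq> S"
    and "\<And>\<C>. \<C> \<subseteq> \<B> \<Longrightarrow> K \<subseteq> \<Union>\<C> \<Longrightarrow> \<exists>\<C>'. finite \<C>' \<and> \<C>' \<subseteq> \<C> \<and> K \<subseteq> \<Union>\<C>'"
  shows "compactin (topology_from_subbasis S \<B>) K"
proof -
  have "compact_space (topology_from_subbasis K (insert K \<B>))"
  proof (rule Alexander_subbase_alt)
    show "\<exists>\<C>'. finite \<C>' \<and> \<C>' \<subseteq> \<C> \<and> K \<subseteq> \<Union>\<C>'" if "\<C> \<subseteq> insert K \<B>" "K \<subseteq> \<Union>\<C>" for \<C>
    proof (cases "K \<in> \<C>")
      case True
      then show ?thesis by (intro exI[of _ "{K}"]) auto
    next
      case False
      with that show ?thesis by (intro assms(2)) auto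
    qed
  qed (auto simp: topology_from_subbasis_def)
  then have "compact_space (subtopology (topology_from_subbasis S \<B>) K)"
    using assms(1)
    by (simp add: topology_from_subbasis_insert_carrier subtopology_topology_from_subbasis
        inf.absorb2)
  then show ?thesis
    using assms(1) by (simp add: compactin_subspace)
qed

text \<open>By distributivity, a finite union of finite intersections of members of \<open>\<B>\<close> is a finite
  intersection of finite unions of members of \<open>\<B>\<close>.\<close>

lemma compactin_subset_finite_Inter_subbasis:
  assumes "compactin (topology_from_subbasis S \<B>) K" "openin (topology_from_subbasis S \<B>) W"
    and "K \<subseteq> W"
    and Union_closed: "\<And>\<F>. finite \<F> \<Longrightarrow> \<F> \<subseteq> \<B> \<Longrightarrow> \<Union>\<F> \<in> \<B>"
  obtains \<F> where "finite \<F>" "\<F> \<subseteq> \<B>" "K \<subseteq> \<Inter>\<F>" "S \<inter> \<Inter>\<F> \<subseteq> W"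
proof -
  define \<A> where "\<A> = {\<F>. finite \<F> \<and> \<F> \<subseteq> \<B> \<and> S \<inter> \<Inter>\<F> \<subseteq> W}"
  have "openin (topology_from_subbasis S \<B>) V" if "V \<in> (\<lambda>\<F>. S \<inter> \<Inter>\<F>) ` \<A>" for V
    using that unfolding openin_topology_from_subbasis_iff \<A>_def by blast
  moreover have "K \<subseteq> (\<Union>\<F>\<in>\<A>. S \<inter> \<Inter>\<F>)"
  proof
    fix x assume "x \<in> K"
    then have "x \<in> W" using assms(3) by blast
    then show "x \<in> (\<Union>\<F>\<in>\<A>. S \<inter> \<Inter>\<F>)"
      using assms(2) unfolding openin_topology_from_subbasis_iff \<A>_def by blast
  qed
  ultimately obtain \<V> where "finite \<V>" "\<V> \<subseteq> (\<lambda>\<F>. S \<inter> \<Inter>\<F>) ` \<A>" "K \<subseteq> \<Union>\<V>"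
    using compactinD[OF assms(1)] by metis
  then obtain \<G> where \<G>: "finite \<G>" "\<G> \<subseteq> \<A>" "K \<subseteq> (\<Union>\<F>\<in>\<G>. S \<inter> \<Inter>\<F>)"
    by (metis finite_subset_image)
  define \<T> where "\<T> = {c ` \<G> |c. \<forall>\<F>\<in>\<G>. c \<F> \<in> \<F>}"
  have distrib: "\<Union>(Inter ` \<G>) = \<Inter>(Union ` \<T>)"
    unfolding \<T>_def by (rule Sup_Inf)
  have "\<T> \<subseteq> Pow (\<Union>\<G>)" unfolding \<T>_def by blast
  moreover have "finite (\<Union>\<G>)" "\<Union>\<G> \<subseteq> \<B>" using \<G>(1,2) by (auto simp: \<A>_def)
  ultimately have "finite \<T>" "\<And>\<F>. \<F> \<in> \<T> \<Longrightarrow> finite \<F> \<and> \<F> \<subseteq> \<B>"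
    by (auto intro: finite_subset)
  then have "finite (Union ` \<T>)" "Union ` \<T> \<subseteq> \<B>"
    using Union_closed by auto
  moreover have "K \<subseteq> \<Inter>(Union ` \<T>)" "S \<inter> \<Inter>(Union ` \<T>) \<subseteq> W"
    using \<G>(2,3) by (auto simp: distrib[symmetric] \<A>_def)
  ultimately show thesis by (rule that)
qed

section \<open>Scott open families of open sets\<close>

lemma openin_opens_space_open: "openin (\<^bold>O Y) \<W> \<Longrightarrow> U \<in> \<W> \<Longrightarrow> openin Y U"
  by (drule openin_subset) auto

lemma openin_opens_space_up:
  "openin (\<^bold>O Y) \<W> \<Longrightarrow> U \<in> \<W> \<Longrightarrow> U \<subseteq> V \<Longrightarrow> openin Y V \<Longrightarrow> V \<in> \<W>"
  unfolding opens_space_def by (auto dest: scott_open_up)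

lemma openin_opens_space_Union_superset:
  assumes "openin (\<^bold>O Y) \<W>" "\<Union>\<F> \<in> \<W>" "\<F> \<subseteq> \<G>" "\<And>U. U \<in> \<G> \<Longrightarrow> openin Y U"
  shows "\<Union>\<G> \<in> \<W>"
  using assms(1,2) Union_mono[OF assms(3)] openin_Union[OF assms(4)]
  by (rule openin_opens_space_up)

lemma openin_opens_space_directed:
  assumes "openin (\<^bold>O Y) \<W>" "\<And>U. U \<in> D \<Longrightarrow> openin Y U" "directed_subset D" "\<Union>D \<in> \<W>"
  shows "\<exists>U\<in>D. U \<in> \<W>"
proof -
  have D: "D \<subseteq> {U. openin Y U}" using assms(2) by blast
  then have "isLub {U. openin Y U} D (\<Union>D)" by (simp add: isLub_open_sets)
  with assms D show ?thesis
    by (auto simp: opens_space_def intro: scott_open_directed)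
qed

lemma directed_subset_finite_Unions: "directed_subset {\<Union>\<F> |\<F>. finite \<F> \<and> \<F> \<subseteq> \<C>}"
  unfolding directed_subset_def
proof (intro conjI ballI)
  fix x y assume "x \<in> {\<Union>\<F> |\<F>. finite \<F> \<and> \<F> \<subseteq> \<C>}" "y \<in> {\<Union>\<F> |\<F>. finite \<F> \<and> \<F> \<subseteq> \<C>}"
  then obtain \<F> \<G> where "finite (\<F> \<union> \<G>)" "\<F> \<union> \<G> \<subseteq> \<C>" "x = \<Union>\<F>" "y = \<Union>\<G>" by blast
  then show "\<exists>z\<in>{\<Union>\<F> |\<F>. finite \<F> \<and> \<F> \<subseteq> \<C>}. x \<le> z \<and> y \<le> z"
    by (intro bexI[of _ "\<Union>(\<F> \<union> \<G>)"]) blast+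
qed blast

lemma openin_opens_space_finite_Union:
  assumes "openin (\<^bold>O Y) \<W>" "\<And>U. U \<in> \<C> \<Longrightarrow> openin Y U" "\<Union>\<C> \<in> \<W>"
  obtains \<F> where "finite \<F>" "\<F> \<subseteq> \<C>" "\<Union>\<F> \<in> \<W>"
proof -
  let ?D = "{\<Union>\<F> |\<F>. finite \<F> \<and> \<F> \<subseteq> \<C>}"
  have "\<Union>{U} \<in> ?D" if "U \<in> \<C>" for U using that by blast
  then have "\<Union>?D = \<Union>\<C>" by auto
  moreover have "openin Y U" if "U \<in> ?D" for U
    using that assms(2) by (auto intro!: openin_Union)
  ultimately have "\<exists>U\<in>?D. U \<in> \<W>"
    using assms(1,3)
    by (intro openin_opens_space_directed[OF _ _ directed_subset_finite_Unions]) simp_all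
  with that show thesis by blast
qed

lemma directed_subset_finite_upper_bound:
  assumes "directed_subset D" "finite F" "F \<subseteq> D"
  shows "\<exists>z\<in>D. \<forall>x\<in>F. x \<le> z"
  using assms(2,3)
proof (induction F rule: finite_induct)
  case empty
  then show ?case using assms(1) by (auto simp: directed_subset_def)
next
  case (insert x F)
  then obtain y where "y \<in> D" "\<forall>x\<in>F. x \<le> y" by auto
  moreover obtain z where "z \<in> D" "x \<le> z" "y \<le> z"
    using insert.prems \<open>y \<in> D\<close> assms(1) unfolding directed_subset_def by blast
  ultimately show ?case by (auto intro: order_trans)
qed

lemma openin_opens_spaceI:
  assumes opens: "\<And>U. U \<in> \<W> \<Longrightarrow> openin Y U"
    and up: "\<And>U V. U \<in> \<W> \<Longrightarrow> openin Y V \<Longrightarrow> U \<subseteq> V \<Longrightarrow> V \<in> \<W>"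
    and finite_Union: "\<And>\<C>. (\<And>U. U \<in> \<C> \<Longrightarrow> openin Y U) \<Longrightarrow> \<Union>\<C> \<in> \<W> \<Longrightarrow>
      \<exists>\<F>. finite \<F> \<and> \<F> \<subseteq> \<C> \<and> \<Union>\<F> \<in> \<W>"
  shows "openin (\<^bold>O Y) \<W>"
  unfolding opens_space_def openin_scott_topology
proof (rule scott_openI)
  show "\<W> \<subseteq> {U. openin Y U}" using opens by (intro subsetI CollectI)
  show "V \<in> \<W>" if "U \<in> \<W>" "V \<in> {U. openin Y U}" "U \<subseteq> V" for U V
    using that by (intro up[of U V]) auto
  fix D s
  assume D: "D \<subseteq> {U. openin Y U}" "directed_subset D" "isLub {U. openin Y U} D s" "s \<in> \<W>"
  then have "\<Union>D \<in> \<W>" by (simp add: isLub_open_sets)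
  then obtain \<F> where \<F>: "finite \<F>" "\<F> \<subseteq> D" "\<Union>\<F> \<in> \<W>"
    using finite_Union D(1) by blast
  obtain V where V: "V \<in> D" "\<Union>\<F> \<subseteq> V"
    using directed_subset_finite_upper_bound[OF D(2) \<F>(1,2)] by blast
  moreover have "openin Y V" using V(1) D(1) by blast
  ultimately have "V \<in> \<W>" by (intro up[OF \<F>(3)])
  with V(1) show "\<exists>U\<in>D. U \<in> \<W>" ..
qed

section \<open>Compact saturated sets of closed sets\<close>

lemma vietoris_diamond_mono: "U \<subseteq> V \<Longrightarrow> vietoris_diamond X U \<subseteq> vietoris_diamond X V"
  unfolding vietoris_diamond_def by blast

lemma vietoris_diamond_Union: "vietoris_diamond X (\<Union>\<C>) = \<Union>(vietoris_diamond X ` \<C>)"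
  unfolding vietoris_diamond_def by blast

lemma vietoris_diamond_complement_iff:
  assumes "B \<in> closed_sets X"
  shows "B \<in> vietoris_diamond X (topspace X - A) \<longleftrightarrow> \<not> B \<subseteq> A"
  using assms closedin_subset[of X B] unfolding vietoris_diamond_def closed_sets_def by blast

lemma openin_vietoris_diamond: "openin X U \<Longrightarrow> openin (\<^bold>A X) (vietoris_diamond X U)"
  unfolding lower_space_def
  by (rule openin_subbasis_member) (auto simp: vietoris_diamond_def)

lemma openin_lower_space_up:
  assumes "openin (\<^bold>A X) W" "A \<in> W" "A \<subseteq> B" "B \<in> closed_sets X"
  shows "B \<in> W"
proof -
  obtain \<F> where \<F>: "\<F> \<subseteq> {vietoris_diamond X U |U. openin X U}" "A \<in> \<Inter>\<F>"
      "closed_sets X \<inter> \<Inter>\<F> \<subseteq> W"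
    using assms(1)[unfolded lower_space_def openin_topology_from_subbasis_iff] assms(2)
    by auto
  have "B \<in> V" if "V \<in> \<F>" for V
  proof -
    obtain U where "V = vietoris_diamond X U" using \<open>V \<in> \<F>\<close> \<F>(1) by blast
    moreover have "A \<in> V" using \<open>V \<in> \<F>\<close> \<F>(2) by blast
    ultimately show ?thesis using assms(3,4) unfolding vietoris_diamond_def by blast
  qed
  with \<F>(3) assms(4) show ?thesis by blast
qed

lemma saturatedin_lower_space_up:
  assumes "saturatedin (\<^bold>A X) \<K>" "A \<in> \<K>" "A \<subseteq> B" "B \<in> closed_sets X"
  shows "B \<in> \<K>"
proof -
  have "B \<in> W" if "openin (\<^bold>A X) W" "\<K> \<subseteq> W" for W
    using openin_lower_space_up[OF that(1)] that(2) assms(2-4) by blast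
  then show ?thesis
    using assms(1) unfolding saturatedin_def by blast
qed

lemma saturatedin_Inter_open:
  assumes "\<And>U. U \<in> \<U> \<Longrightarrow> openin Y U"
  shows "saturatedin Y (topspace Y \<inter> \<Inter>\<U>)"
  unfolding saturatedin_def using assms openin_topspace[of Y] by blast

lemma openin_diamond_neighbourhoods:
  assumes "compactin (\<^bold>A X) \<K>"
  shows "openin (\<^bold>O X) {U. openin X U \<and> \<K> \<subseteq> vietoris_diamond X U}" (is "openin _ ?\<H>")
proof (rule openin_opens_spaceI)
  show "V \<in> ?\<H>" if "U \<in> ?\<H>" "openin X V" "U \<subseteq> V" for U V
    using that vietoris_diamond_mono[OF that(3)] by blast
  fix \<C> assume \<C>: "\<And>U. U \<in> \<C> \<Longrightarrow> openin X U" "\<Union>\<C> \<in> ?\<H>"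
  then have "\<K> \<subseteq> \<Union>(vietoris_diamond X ` \<C>)" by (simp add: vietoris_diamond_Union)
  moreover have "openin (\<^bold>A X) V" if "V \<in> vietoris_diamond X ` \<C>" for V
    using that \<C>(1) openin_vietoris_diamond by blast
  ultimately obtain \<V> where "finite \<V>" "\<V> \<subseteq> vietoris_diamond X ` \<C>" "\<K> \<subseteq> \<Union>\<V>"
    using compactinD[OF assms] by metis
  then obtain \<F> where "finite \<F>" "\<F> \<subseteq> \<C>" "\<K> \<subseteq> vietoris_diamond X (\<Union>\<F>)"
    unfolding vietoris_diamond_Union by (metis finite_subset_image)
  moreover from this have "openin X (\<Union>\<F>)" using \<C>(1) by (intro openin_Union) blast
  ultimately show "\<exists>\<F>. finite \<F> \<and> \<F> \<subseteq> \<C> \<and> \<Union>\<F> \<in> ?\<H>" by blast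
qed blast

lemma compactin_lower_spaceI:
  assumes "\<K> \<subseteq> closed_sets X"
    and \<H>: "openin (\<^bold>O X) {U. openin X U \<and> \<K> \<subseteq> vietoris_diamond X U}" (is "openin _ ?\<H>")
  shows "compactin (\<^bold>A X) \<K>"
  unfolding lower_space_def
proof (intro compactin_topology_from_subbasis assms(1))
  fix \<V> assume "\<V> \<subseteq> {vietoris_diamond X U |U. openin X U}" and cover: "\<K> \<subseteq> \<Union>\<V>"
  then obtain \<C> where \<C>: "\<C> \<subseteq> {U. openin X U}" "\<V> = vietoris_diamond X ` \<C>"
    unfolding image_Collect[symmetric] by (metis subset_imageE)
  then have "\<Union>\<C> \<in> ?\<H>" using cover by (auto simp: vietoris_diamond_Union)
  then obtain \<F> where "finite \<F>" "\<F> \<subseteq> \<C>" "\<Union>\<F> \<in> ?\<H>"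
    using openin_opens_space_finite_Union[OF \<H>] \<C>(1) by blast
  then show "\<exists>\<V>'. finite \<V>' \<and> \<V>' \<subseteq> \<V> \<and> \<K> \<subseteq> \<Union>\<V>'"
    using \<C>(2)
    by (intro exI[of _ "vietoris_diamond X ` \<F>"]) (auto simp: vietoris_diamond_Union)
qed

section \<open>The maps between the powerspaces\<close>

lemma phi_eq:
  assumes "\<K> \<in> compact_saturated_sets (\<^bold>A X)"
  shows "\<phi> X \<K> = {U. openin X U \<and> \<K> \<subseteq> vietoris_diamond X U}"
  using assms unfolding phi_def vietoris_box_def by blast

lemma openin_phi:
  assumes "\<K> \<in> compact_saturated_sets (\<^bold>A X)"
  shows "openin (\<^bold>O X) (\<phi> X \<K>)"
  using assms unfolding phi_eq[OF assms]
  by (intro openin_diamond_neighbourhoods) (simp add: compact_saturated_sets_def)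

lemma psi_subset_diamond_iff:
  assumes "openin (\<^bold>O X) \<H>" "openin X U"
  shows "\<psi> X \<H> \<subseteq> vietoris_diamond X U \<longleftrightarrow> U \<in> \<H>"
proof
  assume "\<psi> X \<H> \<subseteq> vietoris_diamond X U"
  moreover have "topspace X - U \<in> closed_sets X - vietoris_diamond X U"
    using assms(2) by (auto simp: closed_sets_def vietoris_diamond_def)
  ultimately obtain V where V: "V \<in> \<H>" "(topspace X - U) \<inter> V = {}"
    unfolding psi_def vietoris_diamond_def by blast
  then have "V \<subseteq> U"
    using openin_subset[OF openin_opens_space_open[OF assms(1)]] by blast
  with V(1) show "U \<in> \<H>"
    using openin_opens_space_up assms by blast
qed (auto simp: psi_def)

lemma psi_in_compact_saturated_sets:
  assumes "openin (\<^bold>O X) \<H>"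
  shows "\<psi> X \<H> \<in> compact_saturated_sets (\<^bold>A X)"
proof -
  have "{U. openin X U \<and> \<psi> X \<H> \<subseteq> vietoris_diamond X U} = \<H>"
    using psi_subset_diamond_iff[OF assms] openin_opens_space_open[OF assms] by blast
  then have "compactin (\<^bold>A X) (\<psi> X \<H>)"
    using assms by (intro compactin_lower_spaceI) (auto simp: psi_def)
  moreover have "saturatedin (\<^bold>A X) (\<psi> X \<H>)"
    using saturatedin_Inter_open[of "vietoris_diamond X ` \<H>" "\<^bold>A X"]
      openin_vietoris_diamond openin_opens_space_open[OF assms]
    by (auto simp: psi_def)
  ultimately show ?thesis by (simp add: compact_saturated_sets_def)
qed

lemma phi_psi:
  assumes "openin (\<^bold>O X) \<H>"
  shows "\<phi> X (\<psi> X \<H>) = \<H>"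
  using psi_subset_diamond_iff[OF assms] openin_opens_space_open[OF assms]
  unfolding phi_eq[OF psi_in_compact_saturated_sets[OF assms]] by blast

lemma psi_phi:
  assumes "\<K> \<in> compact_saturated_sets (\<^bold>A X)"
  shows "\<psi> X (\<phi> X \<K>) = \<K>"
proof
  have closed: "\<K> \<subseteq> closed_sets X" and saturated: "saturatedin (\<^bold>A X) \<K>"
    using assms compactin_subset_topspace[of "\<^bold>A X" \<K>]
    by (simp_all add: compact_saturated_sets_def)
  show "\<K> \<subseteq> \<psi> X (\<phi> X \<K>)"
    using closed by (auto simp: psi_def phi_eq[OF assms])
  show "\<psi> X (\<phi> X \<K>) \<subseteq> \<K>"
  proof (rule subsetI, rule ccontr)
    fix A assume A: "A \<in> \<psi> X (\<phi> X \<K>)" "A \<notin> \<K>"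
    then have A_closed: "A \<in> closed_sets X" by (simp add: psi_def)
    have "B \<in> vietoris_diamond X (topspace X - A)" if "B \<in> \<K>" for B
    proof -
      have "\<not> B \<subseteq> A"
        using saturatedin_lower_space_up[OF saturated \<open>B \<in> \<K>\<close>] A_closed A(2) by metis
      moreover have "B \<in> closed_sets X" using closed \<open>B \<in> \<K>\<close> by blast
      ultimately show ?thesis by (simp add: vietoris_diamond_complement_iff)
    qed
    then have "topspace X - A \<in> \<phi> X \<K>"
      using A_closed by (auto simp: phi_eq[OF assms] closed_sets_def)
    with A(1) show False by (auto simp: psi_def vietoris_diamond_def)
  qed
qed

lemma phi_in_boxtimes_iff:
  assumes "\<K> \<in> compact_saturated_sets (\<^bold>A X)" "openin X U"
  shows "\<phi> X \<K> \<in> \<boxtimes> X U \<longleftrightarrow> \<K> \<in> vietoris_box (\<^bold>A X) (vietoris_diamond X U)"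
  using assms by (simp add: boxtimes_def openin_phi) (simp add: phi_def)

lemma openin_vietoris_box_subbasis:
  assumes "openin Y W" and Y: "Y = topology_from_subbasis S \<B>"
    and "\<And>\<F>. finite \<F> \<Longrightarrow> \<F> \<subseteq> \<B> \<Longrightarrow> \<Union>\<F> \<in> \<B>"
  shows "openin (topology_from_subbasis (compact_saturated_sets Y) (vietoris_box Y ` \<B>))
    (vietoris_box Y W)"
  unfolding openin_topology_from_subbasis_iff
proof (intro conjI ballI)
  fix K assume "K \<in> vietoris_box Y W"
  then have K: "K \<in> compact_saturated_sets Y" "compactin Y K" "K \<subseteq> W"
    by (auto simp: vietoris_box_def compact_saturated_sets_def)
  obtain \<F> where \<F>: "finite \<F>" "\<F> \<subseteq> \<B>" "K \<subseteq> \<Inter>\<F>" "S \<inter> \<Inter>\<F> \<subseteq> W"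
    using K(2) assms(1) K(3) assms(3) unfolding Y by (rule compactin_subset_finite_Inter_subbasis)
  have "L \<subseteq> W" if "L \<in> compact_saturated_sets Y" "L \<subseteq> \<Inter>\<F>" for L
  proof -
    have "L \<subseteq> S"
      using that(1) compactin_subset_topspace[of Y L] by (simp add: compact_saturated_sets_def Y)
    with that(2) \<F>(4) show ?thesis by blast
  qed
  then have "compact_saturated_sets Y \<inter> \<Inter>(vietoris_box Y ` \<F>) \<subseteq> vietoris_box Y W"
    unfolding vietoris_box_def by blast
  moreover have "K \<in> \<Inter>(vietoris_box Y ` \<F>)"
    using K(1) \<F>(3) unfolding vietoris_box_def by blast
  ultimately show "\<exists>\<G>. finite \<G> \<and> \<G> \<subseteq> vietoris_box Y ` \<B> \<and> K \<in> \<Inter>\<G> \<and>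
      compact_saturated_sets Y \<inter> \<Inter>\<G> \<subseteq> vietoris_box Y W"
    using \<F>(1,2) by (intro exI[of _ "vietoris_box Y ` \<F>"]) auto
qed (auto simp: vietoris_box_def)

lemma upper_space_topology_from_subbasis:
  assumes Y: "Y = topology_from_subbasis S \<B>" and "\<Union>\<B> \<subseteq> S"
    and "\<And>\<F>. finite \<F> \<Longrightarrow> \<F> \<subseteq> \<B> \<Longrightarrow> \<Union>\<F> \<in> \<B>"
  shows "\<^bold>K Y = topology_from_subbasis (compact_saturated_sets Y) (vietoris_box Y ` \<B>)"
    (is "_ = ?T")
  unfolding topology_eq
proof (intro allI iffI)
  fix \<W> assume "openin (\<^bold>K Y) \<W>"
  then show "openin ?T \<W>"
    unfolding upper_space_def
  proof (rule openin_topology_from_subbasis_minimal)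
    show "openin ?T (compact_saturated_sets Y)" using openin_topspace[of ?T] by simp
  qed (use openin_vietoris_box_subbasis[OF _ Y assms(3)] in blast)
next
  fix \<W> assume "openin ?T \<W>"
  then show "openin (\<^bold>K Y) \<W>"
  proof (rule openin_topology_from_subbasis_minimal)
    show "openin (\<^bold>K Y) (compact_saturated_sets Y)" using openin_topspace[of "\<^bold>K Y"] by simp
    fix \<B>' assume "\<B>' \<in> vietoris_box Y ` \<B>"
    then obtain B where B: "B \<in> \<B>" "\<B>' = vietoris_box Y B" by blast
    then have "openin Y B"
      unfolding Y using assms(2) by (intro openin_subbasis_member) auto
    then show "openin (\<^bold>K Y) \<B>'"
      unfolding upper_space_def B(2)
      by (intro openin_subbasis_member) (auto simp: vietoris_box_def)
  qed
qed

lemma upper_lower_space_subbasis: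
  "\<^bold>K (\<^bold>A X) = topology_from_subbasis (compact_saturated_sets (\<^bold>A X))
     ((\<lambda>U. vietoris_box (\<^bold>A X) (vietoris_diamond X U)) ` {U. openin X U})"
proof -
  let ?\<B> = "vietoris_diamond X ` {U. openin X U}"
  have "\<Union>?\<B> \<subseteq> closed_sets X" by (auto simp: vietoris_diamond_def)
  moreover have "\<Union>\<V> \<in> ?\<B>" if \<V>: "\<V> \<subseteq> ?\<B>" for \<V>
  proof -
    obtain \<C> where "\<C> \<subseteq> {U. openin X U}" "\<V> = vietoris_diamond X ` \<C>"
      using \<V> by (metis subset_imageE)
    then have "\<Union>\<V> = vietoris_diamond X (\<Union>\<C>)" "openin X (\<Union>\<C>)"
      by (auto simp: vietoris_diamond_Union)
    then show ?thesis by blast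
  qed
  moreover have "\<^bold>A X = topology_from_subbasis (closed_sets X) ?\<B>"
    by (simp add: lower_space_def setcompr_eq_image)
  ultimately show ?thesis
    using upper_space_topology_from_subbasis[of "\<^bold>A X" "closed_sets X" ?\<B>]
    by (simp add: image_image)
qed

lemma homeomorphic_maps_phi_psi:
  "homeomorphic_maps (\<^bold>K (\<^bold>A X))
     (topology_from_subbasis {\<H>. openin (\<^bold>O X) \<H>} {\<boxtimes> X U |U. openin X U}) (\<phi> X) (\<psi> X)"
  unfolding upper_lower_space_subbasis image_Collect[symmetric]
proof (rule homeomorphic_maps_topology_from_subbasis)
  show "vietoris_box (\<^bold>A X) (vietoris_diamond X U) \<subseteq> compact_saturated_sets (\<^bold>A X)" for U
    unfolding vietoris_box_def by blast
  show "\<boxtimes> X U \<subseteq> {\<H>. openin (\<^bold>O X) \<H>}" for U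
    unfolding boxtimes_def by blast
qed (simp_all add: openin_phi psi_in_compact_saturated_sets psi_phi phi_psi phi_in_boxtimes_iff)

section \<open>The Scott topology on Scott open families\<close>

lemma openin_boxtimes: "openin (\<^bold>O (\<^bold>O X)) (\<boxtimes> X U)"
proof (rule openin_opens_spaceI)
  fix \<C> assume \<C>: "\<And>\<H>. \<H> \<in> \<C> \<Longrightarrow> openin (\<^bold>O X) \<H>" "\<Union>\<C> \<in> \<boxtimes> X U"
  from \<C>(2) obtain \<H> where "\<H> \<in> \<C>" "U \<in> \<H>" by (auto simp: boxtimes_def)
  then show "\<exists>\<F>. finite \<F> \<and> \<F> \<subseteq> \<C> \<and> \<Union>\<F> \<in> \<boxtimes> X U"
    using \<C>(1) by (intro exI[of _ "{\<H>}"]) (simp add: boxtimes_def)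
qed (auto simp: boxtimes_def)

lemma openin_opens_space_Int_tail:
  assumes \<H>: "openin (\<^bold>O Y) \<H>" and \<N>: "\<And>n. openin (\<^bold>O Y) (\<N> n)"
    and tail: "\<And>U. U \<in> \<H> \<Longrightarrow> eventually (\<lambda>n. U \<in> \<N> n) sequentially"
  shows "openin (\<^bold>O Y) (\<H> \<inter> (\<Inter>m\<in>{n..}. \<N> m))"
proof (rule openin_opens_spaceI)
  show "openin Y U" if "U \<in> \<H> \<inter> (\<Inter>m\<in>{n..}. \<N> m)" for U
    using that openin_opens_space_open[OF \<H>] by simp
  show "V \<in> \<H> \<inter> (\<Inter>m\<in>{n..}. \<N> m)"
    if "U \<in> \<H> \<inter> (\<Inter>m\<in>{n..}. \<N> m)" "openin Y V" "U \<subseteq> V" for U V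
    using that(1) openin_opens_space_up[OF \<H> _ that(3,2)] openin_opens_space_up[OF \<N> _ that(3,2)]
    by simp
  fix \<C> assume \<C>: "\<And>U. U \<in> \<C> \<Longrightarrow> openin Y U" "\<Union>\<C> \<in> \<H> \<inter> (\<Inter>m\<in>{n..}. \<N> m)"
  then obtain \<F> where \<F>: "finite \<F>" "\<F> \<subseteq> \<C>" "\<Union>\<F> \<in> \<H>"
    using openin_opens_space_finite_Union[OF \<H>] by (metis IntD1)
  obtain k where k: "\<And>m. m \<ge> k \<Longrightarrow> \<Union>\<F> \<in> \<N> m"
    using tail[OF \<F>(3)] by (auto simp: eventually_sequentially)
  \<comment> \<open>Only the finitely many indices below \<open>k\<close> remain to be dealt with.\<close>
  have "openin (\<^bold>O Y) (\<H> \<inter> \<Inter>(\<N> ` {n..<k}))"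
    using \<H> \<N> by (intro openin_Int_Inter) auto
  moreover have "\<Union>\<C> \<in> \<H> \<inter> \<Inter>(\<N> ` {n..<k})" using \<C>(2) by simp
  ultimately obtain \<G> where \<G>: "finite \<G>" "\<G> \<subseteq> \<C>" "\<Union>\<G> \<in> \<H> \<inter> \<Inter>(\<N> ` {n..<k})"
    using openin_opens_space_finite_Union \<C>(1) by metis
  have opens: "\<And>U. U \<in> \<F> \<union> \<G> \<Longrightarrow> openin Y U" using \<F>(2) \<G>(2) \<C>(1) by blast
  have "\<Union>(\<F> \<union> \<G>) \<in> \<N> m" if "m \<ge> n" for m
  proof (cases "m < k")
    case True
    with \<G>(3) that have "\<Union>\<G> \<in> \<N> m" by simp
    then show ?thesis using opens by (rule openin_opens_space_Union_superset[OF \<N> _ Un_upper2])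
  next
    case False
    then have "\<Union>\<F> \<in> \<N> m" by (intro k) simp
    then show ?thesis using opens by (rule openin_opens_space_Union_superset[OF \<N> _ Un_upper1])
  qed
  moreover have "\<Union>(\<F> \<union> \<G>) \<in> \<H>"
    using \<F>(3) opens by (rule openin_opens_space_Union_superset[OF \<H> _ Un_upper1])
  ultimately show "\<exists>\<F>. finite \<F> \<and> \<F> \<subseteq> \<C> \<and> \<Union>\<F> \<in> \<H> \<inter> (\<Inter>m\<in>{n..}. \<N> m)"
    using \<F>(1,2) \<G>(1,2) by (intro exI[of _ "\<F> \<union> \<G>"]) simp
qed

lemma directed_subset_range_mono:
  fixes f :: "'i::linorder \<Rightarrow> 'a::order"
  assumes "mono f"
  shows "directed_subset (range f)"
proof -
  have "f i \<le> f (max i j)" "f j \<le> f (max i j)" for i j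
    using assms by (auto intro: monoD)
  then show ?thesis unfolding directed_subset_def by blast
qed

lemma eventually_in_scott_open:
  assumes \<W>: "openin (\<^bold>O (\<^bold>O Y)) \<W>" and "\<H> \<in> \<W>"
    and \<N>: "\<And>n. openin (\<^bold>O Y) (\<N> n)"
    and tail: "\<And>U. U \<in> \<H> \<Longrightarrow> eventually (\<lambda>n. U \<in> \<N> n) sequentially"
  shows "eventually (\<lambda>n. \<N> n \<in> \<W>) sequentially"
proof -
  define \<T> where "\<T> = (\<lambda>n. \<H> \<inter> (\<Inter>m\<in>{n..}. \<N> m))"
  have "openin (\<^bold>O Y) \<H>" by (rule openin_opens_space_open[OF \<W> \<open>\<H> \<in> \<W>\<close>])
  then have "openin (\<^bold>O Y) (\<T> n)" for n
    unfolding \<T>_def using \<N> tail by (rule openin_opens_space_Int_tail)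
  moreover have "\<Union>(range \<T>) = \<H>"
    using tail by (fastforce simp: \<T>_def eventually_sequentially)
  moreover have "directed_subset (range \<T>)"
    by (intro directed_subset_range_mono monoI) (auto simp: \<T>_def)
  ultimately obtain n where "\<T> n \<in> \<W>"
    using openin_opens_space_directed[OF \<W>, of "range \<T>"] \<open>\<H> \<in> \<W>\<close> by auto
  moreover have "\<T> n \<subseteq> \<N> m" if "m \<ge> n" for m
    using that by (auto simp: \<T>_def)
  ultimately have "\<N> m \<in> \<W>" if "m \<ge> n" for m
    using that openin_opens_space_up[OF \<W> _ _ \<N>] by blast
  then show ?thesis by (auto simp: eventually_sequentially)
qed

lemma second_countable_scott_open_generators:
  assumes "second_countable X" "openin (\<^bold>O X) \<H>"
  obtains \<G> where "countable \<G>" "\<G> \<subseteq> \<H>" "\<And>U. U \<in> \<H> \<Longrightarrow> \<exists>B\<in>\<G>. B \<subseteq> U"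
proof -
  obtain \<B> where \<B>: "countable \<B>" "\<And>V. V \<in> \<B> \<Longrightarrow> openin X V"
    "\<And>U x. openin X U \<Longrightarrow> x \<in> U \<Longrightarrow> \<exists>V\<in>\<B>. x \<in> V \<and> V \<subseteq> U"
    using assms(1) unfolding second_countable_def by metis
  show thesis
  proof
    show "countable (Union ` {\<F>. finite \<F> \<and> \<F> \<subseteq> \<B>} \<inter> \<H>)"
      using \<B>(1) by (intro countable_Int1 countable_image countable_Collect_finite_subset)
    fix U assume "U \<in> \<H>"
    then have "\<Union>{V \<in> \<B>. V \<subseteq> U} = U"
      using \<B>(3) openin_opens_space_open[OF assms(2)] by blast
    then obtain \<F> where "finite \<F>" "\<F> \<subseteq> {V \<in> \<B>. V \<subseteq> U}" "\<Union>\<F> \<in> \<H>"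
      using openin_opens_space_finite_Union[OF assms(2), of "{V \<in> \<B>. V \<subseteq> U}"] \<B>(2) \<open>U \<in> \<H>\<close>
      by auto
    then show "\<exists>B\<in>Union ` {\<F>. finite \<F> \<and> \<F> \<subseteq> \<B>} \<inter> \<H>. B \<subseteq> U"
      by (intro bexI[of _ "\<Union>\<F>"]) auto
  qed blast
qed

lemma scott_open_finitely_determined:
  assumes "second_countable X" and \<W>: "openin (\<^bold>O (\<^bold>O X)) \<W>" and "\<H> \<in> \<W>"
  obtains F where "finite F" "F \<subseteq> \<H>" "\<And>\<N>. openin (\<^bold>O X) \<N> \<Longrightarrow> F \<subseteq> \<N> \<Longrightarrow> \<N> \<in> \<W>"
proof (rule ccontr)
  assume not_thesis: "\<not> thesis"
  have \<H>: "openin (\<^bold>O X) \<H>"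
    by (rule openin_opens_space_open[OF \<W> \<open>\<H> \<in> \<W>\<close>])
  obtain \<G> where \<G>: "countable \<G>" "\<G> \<subseteq> \<H>" "\<And>U. U \<in> \<H> \<Longrightarrow> \<exists>B\<in>\<G>. B \<subseteq> U"
    using second_countable_scott_open_generators[OF assms(1) \<H>] by blast
  \<comment> \<open>Intersecting with \<open>\<G>\<close> matters only if \<open>\<G> = {}\<close>, where \<open>from_nat_into\<close> has junk values.\<close>
  define F where "F n = \<G> \<inter> from_nat_into \<G> ` {..n}" for n
  have "finite (F n)" "F n \<subseteq> \<H>" for n
    using \<G>(2) by (auto simp: F_def)
  then have "\<exists>\<N>. openin (\<^bold>O X) \<N> \<and> F n \<subseteq> \<N> \<and> \<N> \<notin> \<W>" for n
    using that not_thesis by metis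
  then obtain \<N> where \<N>: "\<And>n. openin (\<^bold>O X) (\<N> n)" "\<And>n. F n \<subseteq> \<N> n" "\<And>n. \<N> n \<notin> \<W>"
    by metis
  have "eventually (\<lambda>n. U \<in> \<N> n) sequentially" if U: "U \<in> \<H>" for U
  proof -
    obtain B where B: "B \<in> \<G>" "B \<subseteq> U" using \<G>(3)[OF U] by blast
    obtain k where "from_nat_into \<G> k = B" using from_nat_into_surj[OF \<G>(1) B(1)] by blast
    then have "B \<in> \<N> n" if "n \<ge> k" for n
      using that B(1) \<N>(2)[of n] by (auto simp: F_def)
    then have "U \<in> \<N> n" if "n \<ge> k" for n
      using that openin_opens_space_up[OF \<N>(1)] B(2) openin_opens_space_open[OF \<H> U]
      by blast
    then show ?thesis by (auto simp: eventually_sequentially)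
  qed
  then have "eventually (\<lambda>n. \<N> n \<in> \<W>) sequentially"
    by (rule eventually_in_scott_open[OF \<W> \<open>\<H> \<in> \<W>\<close> \<N>(1)])
  with \<N>(3) show False by simp
qed

lemma opens_opens_space_subbasis:
  assumes "second_countable X"
  shows "\<^bold>O (\<^bold>O X) = topology_from_subbasis {\<H>. openin (\<^bold>O X) \<H>} {\<boxtimes> X U |U. openin X U}"
    (is "_ = ?T")
  unfolding topology_eq
proof (intro allI iffI)
  fix \<W> assume \<W>: "openin (\<^bold>O (\<^bold>O X)) \<W>"
  show "openin ?T \<W>"
    unfolding openin_topology_from_subbasis_iff
  proof (intro conjI ballI)
    fix \<H> assume "\<H> \<in> \<W>"
    then have \<H>: "openin (\<^bold>O X) \<H>" by (rule openin_opens_space_open[OF \<W>])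
    obtain F where F: "finite F" "F \<subseteq> \<H>" "\<And>\<N>. openin (\<^bold>O X) \<N> \<Longrightarrow> F \<subseteq> \<N> \<Longrightarrow> \<N> \<in> \<W>"
      using scott_open_finitely_determined[OF assms \<W> \<open>\<H> \<in> \<W>\<close>] by blast
    then have "\<boxtimes> X ` F \<subseteq> {\<boxtimes> X U |U. openin X U}" "\<H> \<in> \<Inter>(\<boxtimes> X ` F)"
        "{\<H>. openin (\<^bold>O X) \<H>} \<inter> \<Inter>(\<boxtimes> X ` F) \<subseteq> \<W>"
      using \<H> openin_opens_space_open[OF \<H>] by (auto simp: boxtimes_def)
    with F(1) show "\<exists>\<F>. finite \<F> \<and> \<F> \<subseteq> {\<boxtimes> X U |U. openin X U} \<and> \<H> \<in> \<Inter>\<F> \<and>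
        {\<H>. openin (\<^bold>O X) \<H>} \<inter> \<Inter>\<F> \<subseteq> \<W>"
      by blast
  qed (use openin_opens_space_open[OF \<W>] in blast)
next
  fix \<W> assume "openin ?T \<W>"
  then show "openin (\<^bold>O (\<^bold>O X)) \<W>"
  proof (rule openin_topology_from_subbasis_minimal)
    show "openin (\<^bold>O (\<^bold>O X)) {\<H>. openin (\<^bold>O X) \<H>}"
      using openin_topspace[of "\<^bold>O (\<^bold>O X)"] by simp
  qed (auto intro: openin_boxtimes)
qed

theorem theorem6p11:
  fixes X :: "'a topology"
  assumes "second_countable X"
  shows "homeomorphic_maps (\<^bold>K (\<^bold>A X)) (\<^bold>O (\<^bold>O X)) (\<phi> X) (\<psi> X) \<and>
         \<^bold>O (\<^bold>O X) = topology_from_subbasis {\<H>. openin (\<^bold>O X) \<H>} {\<boxtimes> X U |U. openin X U}"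
proof
  show subbasis: "\<^bold>O (\<^bold>O X) = topology_from_subbasis {\<H>. openin (\<^bold>O X) \<H>} {\<boxtimes> X U |U. openin X U}"
    by (rule opens_opens_space_subbasis[OF assms])
  show "homeomorphic_maps (\<^bold>K (\<^bold>A X)) (\<^bold>O (\<^bold>O X)) (\<phi> X) (\<psi> X)"
    unfolding subbasis by (rule homeomorphic_maps_phi_psi)
qed

end
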